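(* Suppose $\ker\begin{bmatrix}X_-R_-^\top\\ U_-R_-^\top\end{bmatrix}^\top=\{0\}$, let $\sigma_{(U_-,X)}^1,\dots,\sigma_{(U_-,X)}^L\in\mathbb{R}^{n\times(n+m)}$ be the vertices of the convex polytope $\Sigma_{(U_-,X)}^R$, and let $\gamma>0$. The data $(U_-,X)$ are informative for common $\mathcal{H}_\infty$ control with performance $\gamma$ if and only if there exist $Y\in\mathbb{R}^{n\times n}$ and $W\in\mathbb{R}^{m\times n}$ such that, with $Z:=\begin{bmatrix}Y\\ W\end{bmatrix}$, for all $i\in\{1,\dots,L\}$: $$\begin{bmatrix}Y&0&Z^\top(\sigma_{(U_-,X)}^i)^\top&YC^\top\\ 0&\gamma I&I&D^\top\\ \sigma_{(U_-,X)}^iZ&I&Y&0\\ CY&D&0&\gamma I\end{bmatrix}\succ0.$$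
   Context: Let $n,m,M,N,p\ge 1$ be integers. State data $x(0),\dots,x(N)\in\mathbb{R}^n$ and input data $u(0),\dots,u(N-1)\in\mathbb{R}^m$ are collected in $X=[x(0)\ \cdots\ x(N)]$, $X_+=[x(1)\ \cdots\ x(N)]$, $X_-=[x(0)\ \cdots\ x(N-1)]$, $U_-=[u(0)\ \cdots\ u(N-1)]$. An instrumental signal matrix $R_-\in\mathbb{R}^{M\times N}$ and bounds $C_l,C_u\in\mathbb{R}^{n\times M}$ are given. Inequalities $\le$ between matrices are entry-wise; $\succ0$ and $\prec0$ mean symmetric positive definite and symmetric negative definite. The data are generated by a true system $(A_0,B_0)$, i.e. $X_+=A_0X_-+B_0U_-+E_-^0$ for some unknown $E_-^0\in\mathcal{E}_R:=\{E\in\mathbb{R}^{n\times N}\mid C_l\le\tfrac{1}{\sqrt N}ER_-^\top\le C_u\}$. The (hence non-empty) set of feasible systems is $$\Sigma_{(U_-,X)}^R:=\{(A,B)\in\mathbb{R}^{n\times n}\times\mathbb{R}^{n\times m}\mid \exists E_-\in\mathcal{E}_R:\ X_+=AX_-+BU_-+E_-\}.$$ A pair $(A,B)$ is identified with $[A\ \ B]\in\mathbb{R}^{n\times(n+m)}$. Under the kernel condition of the claim, $\Sigma_{(U_-,X)}^R$ is a bounded polyhedron, so it is the convex hull of its finitely many vertices $\sigma_{(U_-,X)}^1,\dots,\sigma_{(U_-,X)}^L$. User-specified performance matrices $C\in\mathbb{R}^{p\times n}$, $D\in\mathbb{R}^{p\times n}$ are given. The data $(U_-,X)$ are informative for common $\mathcal{H}_\infty$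 control with performance $\gamma$ if there exist $K\in\mathbb{R}^{m\times n}$ and $P\succ0$ such that for all $(A,B)\in\Sigma_{(U_-,X)}^R$: $$\begin{bmatrix}I&0\\ A+BK&I\\ 0&I\\ C&D\end{bmatrix}^\top\begin{bmatrix}-P&0&0&0\\ 0&P&0&0\\ 0&0&-\gamma^2I&0\\ 0&0&0&I\end{bmatrix}\begin{bmatrix}I&0\\ A+BK&I\\ 0&I\\ C&D\end{bmatrix}\prec0.$$ *)

theory Defs
  imports "HOL-Analysis.Analysis"
begin

definition pos_def :: "real ^ 'k ^ 'k \<Rightarrow> bool" where
  "pos_def A \<longleftrightarrow> transpose A = A \<and> (\<forall>v. v \<noteq> 0 \<longrightarrow> v \<bullet> (A *v v) > 0)"

definition neg_def :: "real ^ 'k ^ 'k \<Rightarrow> bool" where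
  "neg_def A \<longleftrightarrow> transpose A = A \<and> (\<forall>v. v \<noteq> 0 \<longrightarrow> v \<bullet> (A *v v) < 0)"

text \<open>Block matrices: \<open>A ,, B\<close> is \<open>[A B]\<close> and \<open>A ;; B\<close> puts \<open>A\<close> on top of \<open>B\<close>.
  Both associate to the right, and \<open>,,\<close> binds tighter.\<close>

definition hcat :: "real ^ 'a ^ 'r \<Rightarrow> real ^ 'b ^ 'r \<Rightarrow> real ^ ('a + 'b) ^ 'r" (infixr ",," 57) where
  "A ,, B = (\<chi> i j. case j of Inl k \<Rightarrow> A $ i $ k | Inr k \<Rightarrow> B $ i $ k)"

definition vcat :: "real ^ 'c ^ 'a \<Rightarrow> real ^ 'c ^ 'b \<Rightarrow> real ^ 'c ^ ('a + 'b)" (infixr ";;" 55) where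
  "A ;; B = (\<chi> i. case i of Inl k \<Rightarrow> A $ k | Inr k \<Rightarrow> B $ k)"

text \<open>The columns of an \<open>N\<close>-column data matrix are indexed by a finite linearly ordered type of
  cardinality \<open>N\<close>. Its elements, in increasing order, stand for the times \<open>0, \<dots>, N - 1\<close>.\<close>

definition time :: "'N::{finite,linorder} \<Rightarrow> nat" where
  "time k = card {j. j < k}"

lemma bij_betw_time: "bij_betw (time :: 'N::{finite,linorder} \<Rightarrow> nat) UNIV {..<CARD('N)}"
proof -
  have "time j < time k" if "j < k" for j k :: 'N
    unfolding time_def using that by (intro psubset_card_mono) auto
  hence inj: "inj (time :: 'N \<Rightarrow> nat)"
    by (metis injI less_irrefl linorder_less_linear)
  have "time k < CARD('N)" for k :: 'N
    unfolding time_def by (intro psubset_card_mono) auto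
  hence "range (time :: 'N \<Rightarrow> nat) \<subseteq> {..<CARD('N)}"
    by auto
  hence "range (time :: 'N \<Rightarrow> nat) = {..<CARD('N)}"
    by (rule card_subset_eq[rotated]) (simp_all add: card_image inj)
  with inj show ?thesis
    by (simp add: bij_betw_def)
qed

text \<open>\<open>X\<^sub>-\<close> (or \<open>U\<^sub>-\<close>) and \<open>X\<^sub>+\<close>; only the values \<open>x 0, \<dots>, x N\<close> enter.\<close>

definition data_minus :: "(nat \<Rightarrow> real ^ 'n) \<Rightarrow> real ^ 'N::{finite,linorder} ^ 'n" where
  "data_minus x = (\<chi> i k. x (time k) $ i)"

definition data_plus :: "(nat \<Rightarrow> real ^ 'n) \<Rightarrow> real ^ 'N::{finite,linorder} ^ 'n" where
  "data_plus x = (\<chi> i k. x (Suc (time k)) $ i)"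

text \<open>The library order on \<open>real ^ 'M ^ 'n\<close> is entry-wise.\<close>

definition noise_set ::
  "real ^ 'N ^ 'M \<Rightarrow> real ^ 'M ^ 'n \<Rightarrow> real ^ 'M ^ 'n \<Rightarrow> (real ^ 'N ^ 'n) set" where
  "noise_set R Cl Cu =
     {E. Cl \<le> (1 / sqrt (real CARD('N))) *\<^sub>R (E ** transpose R) \<and>
         (1 / sqrt (real CARD('N))) *\<^sub>R (E ** transpose R) \<le> Cu}"

definition feasible_systems ::
  "(nat \<Rightarrow> real ^ 'm) \<Rightarrow> (nat \<Rightarrow> real ^ 'n) \<Rightarrow> real ^ 'N::{finite,linorder} ^ 'M \<Rightarrow>
   real ^ 'M ^ 'n \<Rightarrow> real ^ 'M ^ 'n \<Rightarrow> ((real ^ 'n ^ 'n) \<times> (real ^ 'm ^ 'n)) set" where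
  "feasible_systems u x R Cl Cu =
     {(A, B). \<exists>E \<in> noise_set R Cl Cu.
        data_plus x = A ** data_minus x + B ** data_minus u + E}"

definition feasible_matrices ::
  "(nat \<Rightarrow> real ^ 'm) \<Rightarrow> (nat \<Rightarrow> real ^ 'n) \<Rightarrow> real ^ 'N::{finite,linorder} ^ 'M \<Rightarrow>
   real ^ 'M ^ 'n \<Rightarrow> real ^ 'M ^ 'n \<Rightarrow> (real ^ ('n + 'm) ^ 'n) set" where
  "feasible_matrices u x R Cl Cu = (\<lambda>(A, B). A ,, B) ` feasible_systems u x R Cl Cu"

definition informative_common_Hinf ::
  "(nat \<Rightarrow> real ^ 'm) \<Rightarrow> (nat \<Rightarrow> real ^ 'n) \<Rightarrow> real ^ 'N::{finite,linorder} ^ 'M \<Rightarrow>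
   real ^ 'M ^ 'n \<Rightarrow> real ^ 'M ^ 'n \<Rightarrow> real ^ 'n ^ 'p \<Rightarrow> real ^ 'n ^ 'p \<Rightarrow> real \<Rightarrow> bool" where
  "informative_common_Hinf u x R Cl Cu C D \<gamma> \<longleftrightarrow>
     (\<exists>(K :: real ^ 'n ^ 'm) (P :: real ^ 'n ^ 'n). pos_def P \<and>
        (\<forall>(A, B) \<in> feasible_systems u x R Cl Cu.
           let F = (mat 1      ,, 0;;
                    A + B ** K ,, mat 1;;
                    0          ,, mat 1;;
                    C          ,, D)
           in neg_def (transpose F **
                (- P ,, 0 ,, 0                        ,, 0;;
                 0   ,, P ,, 0                        ,, 0;;
                 0   ,, 0 ,, - (\<gamma>\<^sup>2 *\<^sub>R mat 1) ,, 0;;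
                 0   ,, 0 ,, 0                        ,, mat 1) ** F)))"

end

theory Submission
  imports Defs
begin

text \<open>
  Two facts give the equivalence. For one system \<open>[A B]\<close>, the matrix inequality at \<open>(Y, W)\<close> is the
  performance condition at \<open>(K, P)\<close> under the change of variables \<open>P = \<gamma> Y\<^sup>-\<^sup>1\<close>, \<open>W = K Y\<close>: this is
  \<open>hinf_lmi_iff_hinf_form\<close>, a Schur complement. It is obtained on vectors: with \<open>\<xi> = Y a\<close>,
  \<open>\<gamma>\<close> times the quadratic form of the large matrix at \<open>(a, w, b, c)\<close> equals minus the quadratic form
  of the performance condition at \<open>(\<xi>, w)\<close>, plus one square in \<open>b\<close> and one in \<open>c\<close>. Both squares
  can be made zero by the choice of \<open>b\<close> and \<open>c\<close>.

  For fixed \<open>(Y, W)\<close> the large matrix is affine in \<open>[A B]\<close>, so the systems that satisfy the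
  inequality form a convex set (\<open>convex_hinf_lmi\<close>).
  Under the kernel condition the set of feasible systems is compact and convex, hence by
  Minkowski's theorem the convex hull of its extreme points, and an inequality that holds at the
  vertices holds on the whole set. Since the new variables depend only on \<open>(K, P)\<close> and not on the
  system, common solutions correspond to common solutions.

  The true system enters once: as the feasible set is non-empty, there is a vertex, and the matrix
  inequality at that vertex forces \<open>Y\<close> to be positive definite.
\<close>

section \<open>Block matrices acting on stacked vectors\<close>

definition stack :: "real ^ 'a \<Rightarrow> real ^ 'b \<Rightarrow> real ^ ('a + 'b)" where
  "stack a b = (\<chi> i. case i of Inl k \<Rightarrow> a $ k | Inr k \<Rightarrow> b $ k)"

lemma sum_over_sum_type:
  "(\<Sum>i\<in>(UNIV :: ('a::finite + 'b::finite) set). f i) = (\<Sum>i\<in>UNIV. f (Inl i)) + (\<Sum>i\<in>UNIV. f (Inr i))"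
  by (subst UNIV_Plus_UNIV[symmetric], subst sum.Plus) (auto simp: o_def)

lemma hcat_mult_stack: "(A ,, B) *v stack a b = A *v a + B *v b"
  by (simp add: vec_eq_iff matrix_vector_mult_def hcat_def stack_def sum_over_sum_type)

lemma vcat_mult_vec: "(A ;; B) *v v = stack (A *v v) (B *v v)"
  by (auto simp: vec_eq_iff matrix_vector_mult_def vcat_def stack_def split: sum.split)

lemma hcat_mult_vcat: "(A ,, B) ** (V ;; W) = A ** V + B ** W"
  by (simp add: vec_eq_iff matrix_matrix_mult_def hcat_def vcat_def sum_over_sum_type)

lemma inner_stack: "stack a b \<bullet> stack c d = a \<bullet> c + b \<bullet> d"
  by (simp add: inner_vec_def stack_def sum_over_sum_type)

lemma stack_eq_0_iff: "stack a b = 0 \<longleftrightarrow> a = 0 \<and> b = 0"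
  by (auto simp: vec_eq_iff stack_def split: sum.split)

lemma ex_stack: "\<exists>a b. v = stack a b"
  by (rule exI[of _ "\<chi> k. v $ Inl k"], rule exI[of _ "\<chi> k. v $ Inr k"])
     (auto simp: vec_eq_iff stack_def split: sum.split)

lemma ex_hcat: "\<exists>A B. S = A ,, B"
  by (rule exI[of _ "\<chi> i k. S $ i $ Inl k"], rule exI[of _ "\<chi> i k. S $ i $ Inr k"])
     (auto simp: vec_eq_iff hcat_def split: sum.split)

lemma transpose_hcat: "transpose (A ,, B) = (transpose A ;; transpose B)"
  by (auto simp: vec_eq_iff transpose_def hcat_def vcat_def split: sum.split)

lemma transpose_vcat: "transpose (A ;; B) = (transpose A ,, transpose B)"
  by (auto simp: vec_eq_iff transpose_def hcat_def vcat_def split: sum.split)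

text \<open>Turns a row of block columns, as it arises from transposing, back into a column of block rows,
  the form in which all block matrices here are written.\<close>

lemma hcat_vcat_interchange: "((A ;; B) ,, (V ;; W)) = (A ,, V ;; B ,, W)"
  by (auto simp: vec_eq_iff hcat_def vcat_def split: sum.split)

lemma hcat_nth: "(A ,, B) $ i $ Inl k = A $ i $ k" "(A ,, B) $ i $ Inr l = B $ i $ l"
  by (simp_all add: hcat_def)

lemma vcat_nth: "(A ;; B) $ Inl k = A $ k" "(A ;; B) $ Inr l = B $ l"
  by (simp_all add: vcat_def)

lemma hcat_eq_iff: "(A ,, B) = (V ,, W) \<longleftrightarrow> A = V \<and> B = W"
  by (metis hcat_nth vec_eq_iff)

lemma vcat_eq_iff: "(A ;; B) = (V ;; W) \<longleftrightarrow> A = V \<and> B = W"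
  by (metis vcat_nth vec_eq_iff)

lemmas block_vec = hcat_mult_stack vcat_mult_vec inner_stack stack_eq_0_iff
lemmas block_transpose = transpose_hcat transpose_vcat hcat_vcat_interchange hcat_eq_iff vcat_eq_iff

section \<open>Positive definite matrices\<close>

lemma inner_transpose_mult:
  fixes A :: "real ^ 'b ^ 'a"
  shows "v \<bullet> (transpose A *v w) = (A *v v) \<bullet> w"
  by (simp add: dot_lmul_matrix inner_commute[of v] inner_commute[of w])

lemma pos_def_nonneg: "pos_def A \<Longrightarrow> 0 \<le> v \<bullet> (A *v v)"
  by (cases "v = 0") (auto simp: pos_def_def intro: less_imp_le)

lemma symmetric_inner:
  fixes A :: "real ^ 'a ^ 'a"
  assumes "transpose A = A"
  shows "v \<bullet> (A *v w) = w \<bullet> (A *v v)"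
  using inner_transpose_mult[of v A w] unfolding assms by (simp only: inner_commute)

lemma transpose_scaleR: "transpose (c *\<^sub>R A) = c *\<^sub>R transpose (A :: real ^ 'a ^ 'b)"
  by (simp add: vec_eq_iff transpose_def)

lemma transpose_zero: "transpose (0 :: real ^ 'a ^ 'b) = 0"
  by (simp add: vec_eq_iff transpose_def)

lemma transpose_minus: "transpose (- A) = - transpose (A :: real ^ 'a ^ 'b)"
  by (simp add: vec_eq_iff transpose_def)

lemma matrix_vector_mult_uminus: "(- A) *v v = - (A *v (v :: real ^ 'a))"
  by (simp add: vec_eq_iff matrix_vector_mult_def sum_negf)

lemma matrix_mult_scaleR:
  fixes A :: "real ^ 'b ^ 'a" and B :: "real ^ 'c ^ 'b"
  shows "(c *\<^sub>R A) ** B = c *\<^sub>R (A ** B)" and "A ** (c *\<^sub>R B) = c *\<^sub>R (A ** B)"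
  by (simp_all add: vec_eq_iff matrix_matrix_mult_def sum_distrib_left mult_ac)

text \<open>The relation between \<open>P\<close> and \<open>Y\<close> is symmetric, so that this serves both to find \<open>Y\<close> from \<open>P\<close>
  and to find \<open>P\<close> from \<open>Y\<close>. Positive definiteness of the inverse \<open>Q\<close> comes from
  \<open>v \<bullet> Q v = (Q v) \<bullet> P (Q v)\<close>.\<close>

lemma pos_def_scaled_inverse:
  fixes P :: "real ^ 'n ^ 'n"
  assumes P: "pos_def P" and "\<gamma> > 0"
  obtains Y where "pos_def Y" "P ** Y = \<gamma> *\<^sub>R mat 1" "Y ** P = \<gamma> *\<^sub>R mat 1"
proof -
  have "\<forall>v. P *v v = 0 \<longrightarrow> v = 0"
    using P by (metis inner_zero_right less_irrefl pos_def_def)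
  then obtain Q where QP: "Q ** P = mat 1"
    using matrix_left_invertible_ker by metis
  hence PQ: "P ** Q = mat 1"
    using matrix_left_right_inverse by blast
  have "transpose Q ** P = mat 1"
    using P arg_cong[OF PQ, of transpose] by (simp add: matrix_transpose_mul pos_def_def transpose_mat)
  hence sym: "transpose Q = Q"
    by (metis PQ matrix_mul_assoc matrix_mul_lid matrix_mul_rid)
  have "v \<bullet> (Q *v v) > 0" if "v \<noteq> 0" for v
  proof -
    have v: "v = P *v (Q *v v)"
      by (simp add: matrix_vector_mul_assoc PQ)
    hence "Q *v v \<noteq> 0" using that by auto
    hence "(Q *v v) \<bullet> (P *v (Q *v v)) > 0" using P by (simp add: pos_def_def)
    thus ?thesis using v by (metis inner_commute)
  qed
  with sym \<open>\<gamma> > 0\<close> have "pos_def (\<gamma> *\<^sub>R Q)"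
    by (simp add: pos_def_def transpose_scaleR scaleR_matrix_vector_assoc[symmetric])
  moreover have "P ** (\<gamma> *\<^sub>R Q) = \<gamma> *\<^sub>R mat 1" "(\<gamma> *\<^sub>R Q) ** P = \<gamma> *\<^sub>R mat 1"
    by (simp_all add: PQ QP matrix_mult_scaleR)
  ultimately show ?thesis using that by blast
qed

section \<open>The performance condition and the matrix inequality for one system\<close>

definition hinf_lmi ::
  "real ^ 'n ^ 'n \<Rightarrow> real ^ 'n ^ 'm \<Rightarrow> real ^ 'n ^ 'p \<Rightarrow> real ^ 'n ^ 'p \<Rightarrow> real \<Rightarrow>
   real ^ ('n + 'm) ^ 'n \<Rightarrow> real ^ ('n + 'n + 'n + 'p) ^ ('n + 'n + 'n + 'p)" where
  "hinf_lmi Y W C D \<gamma> S = (let Z = (Y ;; W) in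
     (Y      ,, 0                 ,, transpose Z ** transpose S ,, Y ** transpose C;;
      0      ,, \<gamma> *\<^sub>R mat 1 ,, mat 1                      ,, transpose D;;
      S ** Z ,, mat 1             ,, Y                          ,, 0;;
      C ** Y ,, D                 ,, 0                          ,, \<gamma> *\<^sub>R mat 1))"

definition hinf_form ::
  "real ^ 'n ^ 'n \<Rightarrow> real ^ 'n ^ 'p \<Rightarrow> real ^ 'n ^ 'p \<Rightarrow> real \<Rightarrow> real ^ 'n ^ 'n \<Rightarrow>
   real ^ ('n + 'n) ^ ('n + 'n)" where
  "hinf_form P C D \<gamma> Acl =
     (let F = (mat 1 ,, 0;;
               Acl   ,, mat 1;;
               0     ,, mat 1;;
               C     ,, D)
      in transpose F **
           (- P ,, 0 ,, 0                        ,, 0;;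
            0   ,, P ,, 0                        ,, 0;;
            0   ,, 0 ,, - (\<gamma>\<^sup>2 *\<^sub>R mat 1) ,, 0;;
            0   ,, 0 ,, 0                        ,, mat 1) ** F)"

text \<open>The closed loop \<open>x\<^sup>+ = Acl x + w\<close>, \<open>z = C x + D w\<close> with storage function \<open>x \<bullet> P x\<close> is strictly
  dissipative with respect to \<open>\<gamma>\<^sup>2 |w|\<^sup>2 - |z|\<^sup>2\<close> when this gap is positive for \<open>(x, w) \<noteq> 0\<close>.\<close>

definition dissipation_gap where
  "dissipation_gap P C D \<gamma> Acl a w =
     a \<bullet> (P *v a) + \<gamma>\<^sup>2 * (w \<bullet> w) - (Acl *v a + w) \<bullet> (P *v (Acl *v a + w))
       - (C *v a + D *v w) \<bullet> (C *v a + D *v w)"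

text \<open>The quadratic form of \<open>hinf_lmi\<close> at the stacked vector \<open>(a, w, b, c)\<close>, for symmetric \<open>Y\<close>.\<close>

definition hinf_quad where
  "hinf_quad Y W C D \<gamma> S a w b c =
     a \<bullet> (Y *v a) + \<gamma> * (w \<bullet> w) + b \<bullet> (Y *v b) + \<gamma> * (c \<bullet> c)
       + 2 * (b \<bullet> (S *v stack (Y *v a) (W *v a) + w)) + 2 * (c \<bullet> (C *v (Y *v a) + D *v w))"

lemma neg_def_hinf_form_iff:
  fixes P :: "real ^ 'n ^ 'n"
  assumes "transpose P = P"
  shows "neg_def (hinf_form P C D \<gamma> Acl) \<longleftrightarrow>
    (\<forall>a w. (a, w) \<noteq> (0, 0) \<longrightarrow> dissipation_gap P C D \<gamma> Acl a w > 0)"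
proof -
  have "transpose (hinf_form P C D \<gamma> Acl) = hinf_form P C D \<gamma> Acl"
    using assms
    by (simp add: hinf_form_def Let_def matrix_transpose_mul matrix_mul_assoc block_transpose
          transpose_minus transpose_scaleR transpose_zero transpose_mat)
  moreover have "stack a w \<bullet> (hinf_form P C D \<gamma> Acl *v stack a w) = - dissipation_gap P C D \<gamma> Acl a w"
    for a w
    by (simp add: hinf_form_def Let_def inner_transpose_mult matrix_vector_mul_assoc[symmetric]
          block_vec matrix_vector_mult_uminus scaleR_matrix_vector_assoc[symmetric] dissipation_gap_def
          del: transpose_matrix_vector)
  moreover have "(\<forall>v :: real ^ ('n + 'n). Q v) \<longleftrightarrow> (\<forall>a w. Q (stack a w))" for Q
    by (metis ex_stack)
  ultimately show ?thesis
    by (simp add: neg_def_def stack_eq_0_iff)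
qed

text \<open>Symmetry of the large matrix is equivalent to symmetry of its corner \<open>Y\<close>, since the
  off-diagonal blocks are already arranged in transposed pairs except for \<open>Y C\<^sup>T\<close> against \<open>C Y\<close>.\<close>

lemma pos_def_hinf_lmi_iff:
  fixes Y :: "real ^ 'n ^ 'n" and C :: "real ^ 'n ^ 'p"
  shows "pos_def (hinf_lmi Y W C D \<gamma> S) \<longleftrightarrow> transpose Y = Y \<and>
    (\<forall>a w b c. (a, w, b, c) \<noteq> (0, 0, 0, 0) \<longrightarrow> hinf_quad Y W C D \<gamma> S a w b c > 0)"
proof -
  have sym: "transpose (hinf_lmi Y W C D \<gamma> S) = hinf_lmi Y W C D \<gamma> S \<longleftrightarrow> transpose Y = Y"
    by (auto simp add: hinf_lmi_def Let_def matrix_transpose_mul block_transpose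
          transpose_scaleR transpose_zero transpose_mat)
  have "stack a (stack w (stack b c)) \<bullet> (hinf_lmi Y W C D \<gamma> S *v stack a (stack w (stack b c)))
      = hinf_quad Y W C D \<gamma> S a w b c" if "transpose Y = Y" for a w b c
  proof -
    have "a \<bullet> ((transpose (Y ;; W) ** transpose S) *v b) = b \<bullet> (S *v stack (Y *v a) (W *v a))"
      by (simp only: matrix_vector_mul_assoc[symmetric] inner_transpose_mult vcat_mult_vec
            inner_commute[of b])
    moreover have "a \<bullet> ((Y ** transpose C) *v c) = c \<bullet> (C *v (Y *v a))"
      using inner_transpose_mult[of a Y "transpose C *v c"] that
      by (simp only: matrix_vector_mul_assoc[symmetric] inner_transpose_mult inner_commute[of c])
    moreover have "w \<bullet> (transpose D *v c) = c \<bullet> (D *v w)"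
      by (simp only: inner_transpose_mult inner_commute[of c])
    ultimately show ?thesis
      by (simp add: hinf_lmi_def Let_def block_vec hinf_quad_def inner_add_right inner_add_left
            matrix_vector_mul_assoc[symmetric] scaleR_matrix_vector_assoc[symmetric] inner_commute[of w b]
            del: transpose_matrix_vector)
  qed
  moreover have "(\<forall>v :: real ^ ('n + 'n + 'n + 'p). Q v) \<longleftrightarrow> (\<forall>a w b c. Q (stack a (stack w (stack b c))))" for Q
    by (metis ex_stack)
  ultimately show ?thesis
    by (auto simp: pos_def_def sym stack_eq_0_iff)
qed

text \<open>This is the Schur complement with respect to the last two block rows, written as a completion
  of squares. In terms of the next state \<open>y\<close> and the output \<open>z\<close>, the part of the form in \<open>b\<close> is
  \<open>b \<bullet> Y b + 2 b \<bullet> y\<close> with minimum \<open>- y \<bullet> Y\<^sup>-\<^sup>1 y\<close>, and the part in \<open>c\<close> is \<open>\<gamma> |c|\<^sup>2 + 2 c \<bullet> z\<close> with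
  minimum \<open>- |z|\<^sup>2 / \<gamma>\<close>. The factor \<open>\<gamma>\<close> turns \<open>\<gamma> Y\<^sup>-\<^sup>1\<close> into \<open>P\<close> and \<open>\<gamma> |w|\<^sup>2\<close> into \<open>\<gamma>\<^sup>2 |w|\<^sup>2\<close>.\<close>

lemma hinf_quad_completed_squares:
  fixes A :: "real ^ 'n ^ 'n" and B :: "real ^ 'm ^ 'n" and K :: "real ^ 'n ^ 'm"
    and C D :: "real ^ 'n ^ 'p"
  assumes Y: "pos_def Y" and PY: "P ** Y = \<gamma> *\<^sub>R mat 1" "Y ** P = \<gamma> *\<^sub>R mat 1" and "\<gamma> > 0"
  defines "y \<equiv> \<lambda>a w. (A + B ** K) *v (Y *v a) + w"
    and "z \<equiv> \<lambda>a w. C *v (Y *v a) + D *v w"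
  shows "\<gamma> * hinf_quad Y (K ** Y) C D \<gamma> (A ,, B) a w b c =
    dissipation_gap P C D \<gamma> (A + B ** K) (Y *v a) w
    + \<gamma> * ((b + (1 / \<gamma>) *\<^sub>R (P *v y a w)) \<bullet> (Y *v (b + (1 / \<gamma>) *\<^sub>R (P *v y a w))))
    + (\<gamma> *\<^sub>R c + z a w) \<bullet> (\<gamma> *\<^sub>R c + z a w)"
proof -
  have PYv: "P *v (Y *v v) = \<gamma> *\<^sub>R v" "Y *v (P *v v) = \<gamma> *\<^sub>R v" for v
    by (simp_all add: matrix_vector_mul_assoc PY scaleR_matrix_vector_assoc[symmetric])
  have sym: "v \<bullet> (Y *v w) = w \<bullet> (Y *v v)" for v w
    using Y symmetric_inner by (auto simp: pos_def_def)
  have S: "(A ,, B) *v stack (Y *v a) ((K ** Y) *v a) + w = y a w"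
    by (simp add: y_def block_vec matrix_vector_mult_add_rdistrib matrix_vector_mul_assoc[symmetric])
  have sq_b: "\<gamma> * ((b + (1 / \<gamma>) *\<^sub>R (P *v v)) \<bullet> (Y *v (b + (1 / \<gamma>) *\<^sub>R (P *v v))))
      = \<gamma> * (b \<bullet> (Y *v b)) + 2 * \<gamma> * (b \<bullet> v) + v \<bullet> (P *v v)" for v
  proof -
    \<comment> \<open>\<open>e\<close> is \<open>Y\<^sup>-\<^sup>1 v\<close>, because \<open>P = \<gamma> Y\<^sup>-\<^sup>1\<close>.\<close>
    define e where "e = (1 / \<gamma>) *\<^sub>R (P *v v)"
    have Ye: "Y *v e = v"
      using \<open>\<gamma> > 0\<close> by (simp add: e_def matrix_vector_mult_scaleR PYv)
    have "\<gamma> * (e \<bullet> v) = v \<bullet> (P *v v)"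
      using \<open>\<gamma> > 0\<close> by (simp add: e_def inner_commute)
    moreover have "(b + e) \<bullet> (Y *v (b + e)) = b \<bullet> (Y *v b) + 2 * (b \<bullet> v) + e \<bullet> v"
      using sym[of e b] by (simp add: matrix_vector_right_distrib inner_add_left inner_add_right Ye)
    ultimately show ?thesis
      unfolding e_def[symmetric] by (simp add: algebra_simps)
  qed
  have sq_c: "(\<gamma> *\<^sub>R c + v) \<bullet> (\<gamma> *\<^sub>R c + v) = \<gamma> * (\<gamma> * (c \<bullet> c) + 2 * (c \<bullet> v)) + v \<bullet> v" for v
    by (simp add: inner_add_left inner_add_right inner_commute[of v c] algebra_simps)
  have gap_eq: "dissipation_gap P C D \<gamma> (A + B ** K) (Y *v a) w
      = \<gamma> * (a \<bullet> (Y *v a)) + \<gamma>\<^sup>2 * (w \<bullet> w) - y a w \<bullet> (P *v y a w) - z a w \<bullet> z a w"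
    by (simp add: dissipation_gap_def y_def z_def PYv inner_commute)
  have quad_eq: "hinf_quad Y (K ** Y) C D \<gamma> (A ,, B) a w b c = a \<bullet> (Y *v a) + \<gamma> * (w \<bullet> w)
      + b \<bullet> (Y *v b) + \<gamma> * (c \<bullet> c) + 2 * (b \<bullet> y a w) + 2 * (c \<bullet> z a w)"
    by (simp add: hinf_quad_def S z_def)
  show ?thesis
    unfolding sq_b sq_c gap_eq quad_eq by (simp add: algebra_simps power2_eq_square)
qed

text \<open>The performance condition follows from the matrix inequality at the minimizers \<open>b\<close>, \<open>c\<close>. In the
  other direction the two squares are non-negative; they alone have to be positive only when
  \<open>a = 0\<close> and \<open>w = 0\<close>, where the form reduces to \<open>b \<bullet> Y b + \<gamma> |c|\<^sup>2\<close>.\<close>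

theorem hinf_lmi_iff_hinf_form:
  fixes A :: "real ^ 'n ^ 'n" and B :: "real ^ 'm ^ 'n"
  assumes Y: "pos_def Y" and P: "pos_def P"
    and PY: "P ** Y = \<gamma> *\<^sub>R mat 1" "Y ** P = \<gamma> *\<^sub>R mat 1" and \<gamma>: "\<gamma> > 0"
  shows "pos_def (hinf_lmi Y (K ** Y) C D \<gamma> (A ,, B)) \<longleftrightarrow> neg_def (hinf_form P C D \<gamma> (A + B ** K))"
    (is "?lmi \<longleftrightarrow> ?perf")
proof -
  note squares = hinf_quad_completed_squares[OF Y PY \<gamma>, of K C D A B]
  have PYv: "P *v (Y *v v) = \<gamma> *\<^sub>R v" "Y *v (P *v v) = \<gamma> *\<^sub>R v" for v
    by (simp_all add: matrix_vector_mul_assoc PY scaleR_matrix_vector_assoc[symmetric])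
  have symP: "transpose P = P" and symY: "transpose Y = Y" and Ypos: "\<And>v. v \<noteq> 0 \<Longrightarrow> v \<bullet> (Y *v v) > 0"
    using P Y by (auto simp: pos_def_def)
  show ?thesis
  proof
    assume ?lmi
    have "dissipation_gap P C D \<gamma> (A + B ** K) v w > 0" if "(v, w) \<noteq> (0, 0)" for v w
    proof -
      \<comment> \<open>\<open>a = Y\<^sup>-\<^sup>1 v\<close> undoes the congruence by \<open>Y\<close>.\<close>
      define a where "a = (1 / \<gamma>) *\<^sub>R (P *v v)"
      have v: "Y *v a = v"
        using \<gamma> by (simp add: a_def matrix_vector_mult_scaleR PYv)
      hence "(a, w) \<noteq> (0, 0)" using that by auto
      \<comment> \<open>The values of \<open>b\<close> and \<open>c\<close> that make both squares vanish.\<close>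
      define b where "b = - ((1 / \<gamma>) *\<^sub>R (P *v ((A + B ** K) *v v + w)))"
      define c where "c = - ((1 / \<gamma>) *\<^sub>R (C *v v + D *v w))"
      have "\<gamma> * hinf_quad Y (K ** Y) C D \<gamma> (A ,, B) a w b c = dissipation_gap P C D \<gamma> (A + B ** K) v w"
      proof -
        have "b + (1 / \<gamma>) *\<^sub>R (P *v ((A + B ** K) *v v + w)) = 0"
          unfolding b_def by (rule left_minus)
        moreover have "\<gamma> *\<^sub>R c + (C *v v + D *v w) = 0"
          using \<gamma> unfolding c_def by (simp only: scaleR_minus_right scaleR_scaleR) simp
        ultimately show ?thesis
          unfolding squares v by (simp only: inner_zero_left mult_zero_right add_0_right)
      qed
      moreover have "hinf_quad Y (K ** Y) C D \<gamma> (A ,, B) a w b c > 0"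
        using \<open>?lmi\<close> \<open>(a, w) \<noteq> (0, 0)\<close> by (auto simp: pos_def_hinf_lmi_iff)
      ultimately show ?thesis using \<gamma> by (metis mult_pos_pos)
    qed
    thus ?perf by (simp add: neg_def_hinf_form_iff[OF symP])
  next
    assume ?perf
    hence gap_pos: "dissipation_gap P C D \<gamma> (A + B ** K) v w > 0" if "(v, w) \<noteq> (0, 0)" for v w
      using that by (simp add: neg_def_hinf_form_iff[OF symP])
    have "hinf_quad Y (K ** Y) C D \<gamma> (A ,, B) a w b c > 0" if "(a, w, b, c) \<noteq> (0, 0, 0, 0)" for a w b c
    proof (cases "a = 0 \<and> w = 0")
      case True
      hence "b \<noteq> 0 \<or> c \<noteq> 0" using that by auto
      hence "b \<bullet> (Y *v b) > 0 \<or> \<gamma> * (c \<bullet> c) > 0"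
        using Ypos \<gamma> by auto
      moreover have "b \<bullet> (Y *v b) \<ge> 0" "\<gamma> * (c \<bullet> c) \<ge> 0"
        using pos_def_nonneg[OF Y] \<gamma> by auto
      ultimately show ?thesis using True by (auto simp: hinf_quad_def block_vec stack_eq_0_iff[THEN iffD2])
    next
      case False
      hence "(Y *v a, w) \<noteq> (0, 0)" using Ypos[of a] by auto
      from gap_pos[OF this] have "\<gamma> * hinf_quad Y (K ** Y) C D \<gamma> (A ,, B) a w b c > 0"
        unfolding squares using pos_def_nonneg[OF Y] \<gamma>
        by (intro add_pos_nonneg mult_nonneg_nonneg inner_ge_zero) auto
      thus ?thesis using \<gamma> by (simp add: zero_less_mult_iff)
    qed
    thus ?lmi using symY by (simp add: pos_def_hinf_lmi_iff)
  qed
qed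

lemma pos_def_of_hinf_lmi:
  assumes "pos_def (hinf_lmi Y W C D \<gamma> S)"
  shows "pos_def Y"
proof -
  have "b \<bullet> (Y *v b) > 0" if "b \<noteq> 0" for b
  proof -
    have "hinf_quad Y W C D \<gamma> S 0 0 b 0 > 0"
      using assms that by (simp add: pos_def_hinf_lmi_iff)
    thus ?thesis by (simp add: hinf_quad_def stack_eq_0_iff[THEN iffD2])
  qed
  moreover have "transpose Y = Y"
    using assms by (simp add: pos_def_hinf_lmi_iff)
  ultimately show ?thesis by (simp add: pos_def_def)
qed

text \<open>The system \<open>S\<close> enters the form only through the term \<open>2 b \<bullet> (S Z a)\<close>, which is linear in \<open>S\<close>.\<close>

lemma convex_hinf_lmi: "convex {S. pos_def (hinf_lmi Y W C D \<gamma> S)}"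
proof (rule convexI)
  fix S T u v
  assume ST: "S \<in> {S. pos_def (hinf_lmi Y W C D \<gamma> S)}" "T \<in> {S. pos_def (hinf_lmi Y W C D \<gamma> S)}"
    and uv: "0 \<le> u" "0 \<le> v" "u + v = (1 :: real)"
  have "hinf_quad Y W C D \<gamma> (u *\<^sub>R S + v *\<^sub>R T) a w b c
      = u * hinf_quad Y W C D \<gamma> S a w b c + v * hinf_quad Y W C D \<gamma> T a w b c" for a w b c
  proof -
    have v: "v = 1 - u" using uv by simp
    show ?thesis
      unfolding v hinf_quad_def
      by (simp add: matrix_vector_mult_add_rdistrib scaleR_matrix_vector_assoc[symmetric]
            inner_add_right algebra_simps)
  qed
  moreover have "u * p + v * q > 0" if "p > 0" "q > 0" for p q :: real
    using uv that by (cases "u = 0") (auto intro: add_pos_nonneg)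
  ultimately show "u *\<^sub>R S + v *\<^sub>R T \<in> {S. pos_def (hinf_lmi Y W C D \<gamma> S)}"
    using ST by (simp add: pos_def_hinf_lmi_iff)
qed

section \<open>The set of feasible systems is a compact convex set\<close>

lemma matrix_mult_add_left:
  fixes A B :: "real ^ 'b ^ 'a"
  shows "(A + B) ** V = A ** V + B ** V"
  by (simp add: vec_eq_iff matrix_matrix_mult_def sum.distrib distrib_right)

lemma linear_mult_right: "linear (\<lambda>S. S ** (G :: real ^ 'c ^ 'b) :: real ^ 'c ^ 'a)"
  by (rule linearI) (simp_all add: matrix_mult_add_left matrix_mult_scaleR)

text \<open>The noise matrix is determined by the system, so the existential quantifier over it disappears
  and only an affine condition on \<open>[A B]\<close> remains. Boxes of matrices in the entry-wise order are
  convex and compact.\<close>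

lemma feasible_matrices_eq_vimage:
  fixes x :: "nat \<Rightarrow> real ^ 'n" and u :: "nat \<Rightarrow> real ^ 'm"
    and R :: "real ^ 'N::{finite,linorder} ^ 'M"
  defines "G \<equiv> (data_minus x ** transpose R ;; data_minus u ** transpose R)"
  shows "feasible_matrices u x R Cl Cu =
    (\<lambda>S. (1 / sqrt (real CARD('N))) *\<^sub>R (data_plus x ** transpose R - S ** G)) -` {Cl..Cu}"
proof -
  let ?c = "1 / sqrt (real CARD('N))"
  have "(A ,, B) \<in> feasible_matrices u x R Cl Cu \<longleftrightarrow>
      ?c *\<^sub>R (data_plus x ** transpose R - (A ,, B) ** G) \<in> {Cl..Cu}" for A B
  proof -
    have "(A ,, B) \<in> feasible_matrices u x R Cl Cu \<longleftrightarrow>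
        data_plus x - (A ** data_minus x + B ** data_minus u) \<in> noise_set R Cl Cu"
      by (force simp: feasible_matrices_def feasible_systems_def hcat_eq_iff algebra_simps)
    also have "(data_plus x - (A ** data_minus x + B ** data_minus u)) ** transpose R
        = data_plus x ** transpose R - (A ,, B) ** G"
      by (simp add: G_def hcat_mult_vcat linear_diff[OF linear_mult_right] matrix_mult_add_left matrix_mul_assoc)
    hence "data_plus x - (A ** data_minus x + B ** data_minus u) \<in> noise_set R Cl Cu \<longleftrightarrow>
        ?c *\<^sub>R (data_plus x ** transpose R - (A ,, B) ** G) \<in> {Cl..Cu}"
      by (simp add: noise_set_def)
    finally show ?thesis .
  qed
  thus ?thesis using ex_hcat by (metis (no_types, lifting) subsetI subset_antisym vimageE vimageI)
qed

lemma convex_affine_matrix_vimage: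
  fixes X :: "real ^ 'c ^ 'a" and G :: "real ^ 'c ^ 'b"
  shows "convex ((\<lambda>S. c *\<^sub>R (X - S ** G)) -` {Cl..Cu})"
proof (rule convexI)
  fix S T u v
  assume ST: "S \<in> (\<lambda>S. c *\<^sub>R (X - S ** G)) -` {Cl..Cu}" "T \<in> (\<lambda>S. c *\<^sub>R (X - S ** G)) -` {Cl..Cu}"
    and uv: "0 \<le> u" "0 \<le> v" "u + v = (1 :: real)"
  have "c *\<^sub>R (X - (u *\<^sub>R S + v *\<^sub>R T) ** G) = u *\<^sub>R (c *\<^sub>R (X - S ** G)) + v *\<^sub>R (c *\<^sub>R (X - T ** G))"
  proof -
    have v: "v = 1 - u" using uv by simp
    show ?thesis unfolding v
      by (simp add: linear_add[OF linear_mult_right] linear_cmul[OF linear_mult_right]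
            linear_diff[OF linear_mult_right] algebra_simps)
  qed
  moreover have "\<dots> \<in> {Cl..Cu}"
    using ST uv by (intro convexD[OF convex_closed_interval]) (auto simp: vimage_def)
  ultimately show "u *\<^sub>R S + v *\<^sub>R T \<in> (\<lambda>S. c *\<^sub>R (X - S ** G)) -` {Cl..Cu}" by simp
qed

lemma convex_feasible_matrices: "convex (feasible_matrices u x R Cl Cu)"
  unfolding feasible_matrices_eq_vimage by (rule convex_affine_matrix_vimage)

text \<open>The kernel condition says that \<open>G\<^sup>T\<close> is injective, so \<open>G\<close> has a right inverse. A feasible system
  can then be recovered, by the continuous map \<open>g\<close> below, from the value of the affine map that lies
  in the compact box \<open>{Cl..Cu}\<close>; this bounds the feasible set.\<close>

lemma compact_feasible_matrices:
  fixes x :: "nat \<Rightarrow> real ^ 'n" and u :: "nat \<Rightarrow> real ^ 'm"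
    and R :: "real ^ 'N::{finite,linorder} ^ 'M"
  assumes kernel: "{v. transpose (data_minus x ** transpose R ;; data_minus u ** transpose R) *v v = 0} = {0}"
  shows "compact (feasible_matrices u x R Cl Cu)"
proof -
  define G where "G = (data_minus x ** transpose R ;; data_minus u ** transpose R)"
  define c where "c = 1 / sqrt (real CARD('N))"
  have "c \<noteq> 0" by (simp add: c_def)
  define X where "X = data_plus x ** transpose R"
  define f where "f S = c *\<^sub>R (X - S ** G)" for S :: "real ^ ('n + 'm) ^ 'n"
  have feas: "feasible_matrices u x R Cl Cu = f -` {Cl..Cu}"
    by (simp add: feasible_matrices_eq_vimage f_def[abs_def] c_def X_def G_def)
  obtain H where "H ** transpose G = mat 1"
    using kernel matrix_left_invertible_ker[of "transpose G"] by (auto simp: G_def)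
  hence GH: "G ** transpose H = mat 1"
    by (metis matrix_transpose_mul transpose_mat transpose_transpose)
  define g where "g T = (X - (1 / c) *\<^sub>R T) ** transpose H" for T
  have "g (f S) = S" for S
    using \<open>c \<noteq> 0\<close> by (simp add: g_def f_def matrix_mul_assoc[symmetric] GH)
  hence sub: "f -` {Cl..Cu} \<subseteq> g ` {Cl..Cu}"
    by (metis image_eqI subsetI vimageE)
  have cont_mult: "continuous_on T (\<lambda>S. S ** Q)" for T :: "(real ^ 'a ^ 'b) set" and Q :: "real ^ 'd ^ 'a"
    by (intro linear_continuous_on) (simp add: linear_linear linear_mult_right)
  have "continuous_on {Cl..Cu} g"
    unfolding g_def[abs_def]
    by (rule continuous_on_compose2[OF cont_mult[of UNIV "transpose H"]]) (auto intro!: continuous_intros)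
  hence "bounded (g ` {Cl..Cu})"
    by (intro compact_imp_bounded compact_continuous_image compact_interval)
  moreover have "closed (f -` {Cl..Cu})"
    unfolding f_def[abs_def] by (intro closed_vimage closed_eucl_atLeastAtMost continuous_intros cont_mult)
  ultimately show ?thesis
    unfolding feas compact_eq_bounded_closed using sub bounded_subset by blast
qed

theorem corollary20:
  fixes x :: "nat \<Rightarrow> real ^ 'n"
    and u :: "nat \<Rightarrow> real ^ 'm"
    and R :: "real ^ 'N::{finite,linorder} ^ 'M"
    and Cl Cu :: "real ^ 'M ^ 'n"
    and A0 :: "real ^ 'n ^ 'n"
    and B0 :: "real ^ 'm ^ 'n"
    and E0 :: "real ^ 'N::{finite,linorder} ^ 'n"
    and C D :: "real ^ 'n ^ 'p"
    and \<gamma> :: real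
    and L :: nat
    and \<sigma> :: "nat \<Rightarrow> real ^ ('n + 'm) ^ 'n"
  assumes true_system: "data_plus x = A0 ** data_minus x + B0 ** data_minus u + E0"
    and true_noise: "E0 \<in> noise_set R Cl Cu"
    and kernel: "{v. transpose (data_minus x ** transpose R ;; data_minus u ** transpose R) *v v = 0} = {0}"
    and vertices: "bij_betw \<sigma> {1..L} {v. v extreme_point_of feasible_matrices u x R Cl Cu}"
    and "\<gamma> > 0"
  shows "informative_common_Hinf u x R Cl Cu C D \<gamma> \<longleftrightarrow>
    (\<exists>(Y :: real ^ 'n ^ 'n) (W :: real ^ 'n ^ 'm).
       let Z = (Y ;; W) in
       \<forall>i \<in> {1..L}.
         pos_def
           (Y          ,, 0            ,, transpose Z ** transpose (\<sigma> i) ,, Y ** transpose C;;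
            0          ,, \<gamma> *\<^sub>R mat 1 ,, mat 1                          ,, transpose D;;
            \<sigma> i ** Z ,, mat 1        ,, Y                               ,, 0;;
            C ** Y     ,, D            ,, 0                               ,, \<gamma> *\<^sub>R mat 1))"
proof -
  let ?\<Sigma> = "feasible_matrices u x R Cl Cu"
  have hull: "?\<Sigma> = convex hull (\<sigma> ` {1..L})"
    using Krein_Milman_Minkowski[OF compact_feasible_matrices[OF kernel] convex_feasible_matrices]
      bij_betw_imp_surj_on[OF vertices] by metis
  have "(A0 ,, B0) \<in> ?\<Sigma>"
    using true_system true_noise by (auto simp: feasible_matrices_def feasible_systems_def)
  hence "{1..L} \<noteq> {}" using hull by (metis convex_hull_empty empty_iff image_empty)
  then obtain i0 where i0: "i0 \<in> {1..L}" by blast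
  have informative: "informative_common_Hinf u x R Cl Cu C D \<gamma> \<longleftrightarrow>
      (\<exists>K P. pos_def P \<and> (\<forall>A B. (A ,, B) \<in> ?\<Sigma> \<longrightarrow> neg_def (hinf_form P C D \<gamma> (A + B ** K))))"
  proof -
    have "(A ,, B) \<in> ?\<Sigma> \<longleftrightarrow> (A, B) \<in> feasible_systems u x R Cl Cu" for A B
      by (auto simp: feasible_matrices_def hcat_eq_iff)
    thus ?thesis
      by (simp add: informative_common_Hinf_def hinf_form_def Let_def Ball_def)
  qed
  have "informative_common_Hinf u x R Cl Cu C D \<gamma> \<longleftrightarrow>
      (\<exists>Y W. \<forall>i\<in>{1..L}. pos_def (hinf_lmi Y W C D \<gamma> (\<sigma> i)))"
  proof
    assume "informative_common_Hinf u x R Cl Cu C D \<gamma>"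
    then obtain K P where P: "pos_def P"
      and perf: "\<And>A B. (A ,, B) \<in> ?\<Sigma> \<Longrightarrow> neg_def (hinf_form P C D \<gamma> (A + B ** K))"
      unfolding informative by blast
    obtain Y where Y: "pos_def Y" "P ** Y = \<gamma> *\<^sub>R mat 1" "Y ** P = \<gamma> *\<^sub>R mat 1"
      using pos_def_scaled_inverse[OF P \<open>\<gamma> > 0\<close>] .
    have "pos_def (hinf_lmi Y (K ** Y) C D \<gamma> (\<sigma> i))" if "i \<in> {1..L}" for i
    proof -
      obtain A B where AB: "\<sigma> i = A ,, B" using ex_hcat by blast
      have "\<sigma> i \<in> convex hull (\<sigma> ` {1..L})" using that by (intro hull_inc imageI)
      hence "neg_def (hinf_form P C D \<gamma> (A + B ** K))"
        using perf hull AB by metis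
      thus ?thesis
        unfolding AB hinf_lmi_iff_hinf_form[OF Y(1) P Y(2,3) \<open>\<gamma> > 0\<close>] .
    qed
    thus "\<exists>Y W. \<forall>i\<in>{1..L}. pos_def (hinf_lmi Y W C D \<gamma> (\<sigma> i))" by blast
  next
    assume "\<exists>Y W. \<forall>i\<in>{1..L}. pos_def (hinf_lmi Y W C D \<gamma> (\<sigma> i))"
    then obtain Y W where lmi: "\<And>i. i \<in> {1..L} \<Longrightarrow> pos_def (hinf_lmi Y W C D \<gamma> (\<sigma> i))" by blast
    have lmi_all: "pos_def (hinf_lmi Y W C D \<gamma> S)" if "S \<in> ?\<Sigma>" for S
    proof -
      have "convex hull (\<sigma> ` {1..L}) \<subseteq> {S. pos_def (hinf_lmi Y W C D \<gamma> S)}"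
        using lmi convex_hinf_lmi by (intro hull_minimal) auto
      thus ?thesis using that hull by blast
    qed
    have Y: "pos_def Y"
      using lmi[OF i0] by (rule pos_def_of_hinf_lmi)
    obtain P where P: "pos_def P" "Y ** P = \<gamma> *\<^sub>R mat 1" "P ** Y = \<gamma> *\<^sub>R mat 1"
      using pos_def_scaled_inverse[OF Y \<open>\<gamma> > 0\<close>] .
    \<comment> \<open>\<open>K = W Y\<^sup>-\<^sup>1\<close>\<close>
    define K where "K = (1 / \<gamma>) *\<^sub>R (W ** P)"
    have "K ** Y = W"
      using \<open>\<gamma> > 0\<close> by (simp add: K_def scalar_matrix_assoc[symmetric] matrix_mul_assoc[symmetric] P matrix_scalar_ac)
    hence "neg_def (hinf_form P C D \<gamma> (A + B ** K))" if "(A ,, B) \<in> ?\<Sigma>" for A B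
      using lmi_all[OF that] hinf_lmi_iff_hinf_form[OF Y P(1) P(3,2) \<open>\<gamma> > 0\<close>] by metis
    thus "informative_common_Hinf u x R Cl Cu C D \<gamma>"
      unfolding informative using P(1) by blast
  qed
  thus ?thesis by (simp add: hinf_lmi_def Let_def)
qed

end
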